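(* Let $R$ be a finite commutative ring with unity and let $\Gamma'(R)$ be the unity product graph associated with $R$. If $|V(\Gamma'(R))|\geq 2$, then $\Gamma'(R)$ is disconnected.
   Context: For a ring $R$ with unity $e$, let $U(R)$ denote the set of units of $R$. The unity product graph $\Gamma'(R)$ is the simple graph with vertex set $V(\Gamma'(R))=U(R)$ in which two distinct vertices $r_i,r_j$ are adjacent if and only if $r_i\cdot r_j=e$. A graph is connected if there is a path between every two vertices, and disconnected otherwise. *)

theory Defs
  imports "HOL-Algebra.Ring" "Graph_Theory.Digraph_Component"
begin

text \<open>
  A simple graph is represented, following \<^theory>\<open>Graph_Theory.Digraph\<close>, as a symmetric
  loop-free digraph without parallel arcs: an edge between \<open>x\<close> and \<open>y\<close> is the pair of arcs
  \<open>(x, y)\<close>, \<open>(y, x)\<close>.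
\<close>

definition unity_product_graph :: "('a, 'b) ring_scheme \<Rightarrow> 'a pair_pre_digraph" where
  "unity_product_graph R =
    \<lparr> pverts = Units R,
      parcs = {(x, y). x \<in> Units R \<and> y \<in> Units R \<and> x \<noteq> y \<and> x \<otimes>\<^bsub>R\<^esub> y = \<one>\<^bsub>R\<^esub>} \<rparr>"

lemma pair_graph_unity_product_graph:
  assumes "cring R" and "finite (carrier R)"
  shows "pair_graph (unity_product_graph R)"
proof -
  interpret cring R by fact
  have fin: "finite (Units R)"
    using assms(2) Units_closed by (meson finite_subset subsetI)
  have "finite {(x, y). x \<in> Units R \<and> y \<in> Units R \<and> x \<noteq> y \<and> x \<otimes>\<^bsub>R\<^esub> y = \<one>\<^bsub>R\<^esub>}"
    by (rule finite_subset[OF _ finite_cartesian_product[OF fin fin]]) auto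
  then show ?thesis
    using fin
    by unfold_locales
      (auto simp: unity_product_graph_def symmetric_def m_comm Units_closed intro!: symI)
qed

end

theory Submission
  imports Defs
begin

text \<open>
  The unity is an isolated vertex: a neighbour \<open>y\<close> of \<open>\<one>\<close> would satisfy \<open>y = \<one> \<otimes> y = \<one>\<close>, but
  edges join distinct vertices. A graph with an isolated vertex and at least one further vertex
  is disconnected, because a walk from the isolated vertex to another one would have to begin
  with an edge at it.
\<close>

lemma (in ring) unity_isolated:
  shows "(\<one>, y) \<notin> parcs (unity_product_graph R)" and "(y, \<one>) \<notin> parcs (unity_product_graph R)"
  by (auto simp: unity_product_graph_def dest: Units_closed)

text \<open>
  For digraphs, connectedness means reachability in the symmetric closure, so an isolated vertex
  must be neither the tail nor the head of an arc.
\<close>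

lemma not_connected_if_isolated_vertex:
  assumes "v \<in> pverts G" and "w \<in> pverts G" and "v \<noteq> w"
    and isolated: "\<And>x. (v, x) \<notin> parcs G" "\<And>x. (x, v) \<notin> parcs G"
  shows "\<not> Digraph_Component.connected (with_proj G)"
proof
  assume "Digraph_Component.connected (with_proj G)"
  then have "v \<rightarrow>\<^sup>*\<^bsub>with_proj (mk_symmetric (with_proj G))\<^esub> w"
    using assms(1,2) by (auto simp: connected_def strongly_connected_def)
  then show False
    using \<open>v \<noteq> w\<close> isolated
    unfolding reachable_def
    by (cases rule: converse_rtrancl_on_cases) (auto simp: parcs_mk_symmetric)
qed

theorem theorem3p2:
  fixes R :: "('a, 'b) ring_scheme"
  assumes "cring R"
    and "finite (carrier R)"
    and "card (pverts (unity_product_graph R)) \<ge> 2"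
  shows "\<not> Digraph_Component.connected (with_proj (unity_product_graph R))"
proof -
  interpret cring R by fact
  have one: "\<one>\<^bsub>R\<^esub> \<in> pverts (unity_product_graph R)"
    by (simp add: unity_product_graph_def)
  have "\<not> pverts (unity_product_graph R) \<subseteq> {\<one>\<^bsub>R\<^esub>}"
    using assms(3) card_mono[of "{\<one>\<^bsub>R\<^esub>}" "pverts (unity_product_graph R)"] by auto
  then obtain u where "u \<in> pverts (unity_product_graph R)" "\<one>\<^bsub>R\<^esub> \<noteq> u"
    by auto
  with one show ?thesis
    using unity_isolated by (rule not_connected_if_isolated_vertex)
qed

end
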